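(* Let $\theta\in(0,\pi)$ and $\nu,\mu\in\mathbb{C}$ with $\nu+\mu\in\mathbb{C}\setminus-\mathbb{N}$. Consider the series $$\sqrt{\pi}\,2^\mu(\sin\theta)^\mu\sum_{k=0}^\infty\frac{\Gamma(\nu+\mu+k+1)}{\Gamma(\nu+k+\frac32)}\frac{(\mu+\frac12)_k}{k!}\cos((\nu+\mu+2k+1)\theta).\qquad(\ast)$$ (a) If $\operatorname{Re}\mu<0$, then the series $(\ast)$ converges absolutely. (b) If $0\le\operatorname{Re}\mu<\frac12$, then the series $(\ast)$ converges, but, if $\theta\neq\frac12\pi$, it does not converge absolutely. (c) If $\operatorname{Re}\mu\ge\frac12$ and $\theta\neq\frac12\pi$, then the series $(\ast)$ diverges.
   Context: $-\mathbb{N}=\{-1,-2,\dots\}$. $(a)_k=a(a+1)\cdots(a+k-1)$ is the Pochhammer symbol, with $(a)_0=1$. $1/\Gamma$ is read as the entire function (zero at the poles of $\Gamma$). *)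

theory Defs
  imports "HOL-Complex_Analysis.Complex_Analysis"
begin

text \<open>The set $-\mathbb{N} = \{-1,-2,\dots\}$; zero is excluded, unlike in the library's \<^term>\<open>\<nat>\<close>.\<close>

definition neg_Nats :: "complex set" where
  "neg_Nats = {- of_nat n |n. n \<ge> 1}"

text \<open>The \<open>k\<close>-th term of the series, with the constant prefactor multiplied in. The powers are
  principal values with positive real base (for \<open>0 < \<theta> < \<pi>\<close>), and \<^const>\<open>rGamma\<close> is the entire
  function \<open>1/\<Gamma>\<close>.\<close>

definition series_term :: "complex \<Rightarrow> complex \<Rightarrow> real \<Rightarrow> nat \<Rightarrow> complex" where
  "series_term \<nu> \<mu> \<theta> k =
     of_real (sqrt pi) * 2 powr \<mu> * of_real (sin \<theta>) powr \<mu> *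
     (Gamma (\<nu> + \<mu> + of_nat k + 1) * rGamma (\<nu> + of_nat k + 3 / 2) *
      (pochhammer (\<mu> + 1 / 2) k / fact k) *
      cos ((\<nu> + \<mu> + 2 * of_nat k + 1) * of_real \<theta>))"

end

theory Submission
  imports Defs "HOL-Real_Asymp.Real_Asymp"
begin

text \<open>
  The coefficient of the cosine in the \<open>k\<close>-th term is asymptotic to
  \<open>k powr (2 * \<mu> - 1) / \<Gamma> (\<mu> + 1/2)\<close>, and its increments are at most of order
  \<open>k powr (2 * Re \<mu> - 2)\<close>. Absolute convergence for \<open>Re \<mu> < 0\<close> is then immediate, and
  convergence for \<open>Re \<mu> < 1/2\<close> is Dirichlet's test, applied to the two exponentials of the cosine.
  If \<open>\<theta> \<noteq> \<pi>/2\<close>, no two consecutive cosines can both be close to zero, so the norms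
  of two consecutive terms add up to at least a multiple of \<open>k powr (2 * Re \<mu> - 1)\<close> when
  \<open>Re \<mu> \<ge> 0\<close>.
\<close>

section \<open>Asymptotics of Pochhammer symbols and of the reciprocal Gamma function\<close>

lemma Re_pos_imp_not_nonpos_Ints:
  fixes z :: complex
  assumes "0 < Re z"
  shows "z \<notin> \<int>\<^sub>\<le>\<^sub>0"
  using assms
  by (metis nonpos_Ints_cases Re_complex_of_real of_real_of_int_eq of_int_0_less_iff not_le)

text \<open>Euler's limit \<open>rGamma_series z k\<close> contains
  \<open>pochhammer z (Suc k)\<close>. Its last factor \<open>z + k\<close>, divided by
  \<open>k\<close>, is \<open>1 + z / k\<close> and tends to 1, so it can be removed.\<close>

lemma pochhammer_asymptotics:
  fixes z :: complex
  shows "(\<lambda>k. pochhammer z k / fact k * of_nat k powr (1 - z)) \<longlonglongrightarrow> rGamma z"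
proof -
  have lim: "(\<lambda>k. 1 / (1 + z * inverse (of_nat k))) \<longlonglongrightarrow> 1 / (1 + z * 0)"
    by (intro tendsto_intros lim_inverse_n) auto
  have "(\<lambda>k. rGamma_series z k * (1 / (1 + z * inverse (of_nat k)))) \<longlonglongrightarrow> rGamma z * (1 / (1 + z * 0))"
    by (intro tendsto_mult lim rGamma_series_LIMSEQ)
  moreover have "eventually (\<lambda>k. rGamma_series z k * (1 / (1 + z * inverse (of_nat k)))
      = pochhammer z k / fact k * of_nat k powr (1 - z)) sequentially"
    \<comment> \<open>Beyond \<open>norm z\<close> the factor \<open>z + k\<close> is nonzero and
      may be cancelled.\<close>
    using eventually_gt_at_top[of "nat \<lceil>norm z\<rceil>"]
  proof eventually_elim
    case (elim k)
    have k: "real k > norm z" "k > 0" using elim by linarith+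
    have nz: "z + of_nat k \<noteq> 0"
    proof
      assume "z + of_nat k = 0"
      then have "z = - of_nat k" by (simp add: eq_neg_iff_add_eq_0)
      then show False using k by simp
    qed
    have "exp (z * of_real (ln (real k))) = of_nat k powr z"
      using k by (simp add: powr_def Ln_of_nat)
    moreover have "of_nat k powr (1 - z) = of_nat k / of_nat k powr z"
      using k by (simp add: powr_diff)
    moreover have "1 + z * inverse (of_nat k) = (z + of_nat k) / of_nat k"
      using k by (simp add: field_simps)
    moreover have "rGamma_series z k =
        pochhammer z k * (z + of_nat k) / (fact k * exp (z * of_real (ln (real k))))"
      by (simp add: rGamma_series_def pochhammer_rec')
    ultimately show ?case
      using k nz by simp
  qed
  ultimately show ?thesis
    by (auto intro: Lim_transform_eventually)
qed

lemma of_nat_Suc_powr_ratio: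
  fixes z :: complex
  shows "(\<lambda>k. of_nat (Suc k) powr z / of_nat k powr z) \<longlonglongrightarrow> 1"
proof -
  have "(\<lambda>k::nat. ln (real k + 1) - ln (real k)) \<longlonglongrightarrow> 0"
    by real_asymp
  then have "(\<lambda>k::nat. exp (z * of_real (ln (real k + 1) - ln (real k)))) \<longlonglongrightarrow> exp (z * of_real 0)"
    by (intro tendsto_intros)
  moreover have "eventually (\<lambda>k. exp (z * of_real (ln (real k + 1) - ln (real k)))
      = of_nat (Suc k) powr z / of_nat k powr z) sequentially"
    using eventually_gt_at_top[of 0]
  proof eventually_elim
    case (elim k)
    have "Ln (of_nat (Suc k)) = of_real (ln (real k + 1))"
      using Ln_of_nat[of "Suc k"] by (simp add: add.commute)
    moreover have "Ln (of_nat k) = of_real (ln (real k))"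
      using elim by (simp add: Ln_of_nat)
    moreover have "complex_of_nat (Suc k) \<noteq> 0" by (simp del: of_nat_Suc)
    ultimately show ?case
      using elim by (simp only: powr_def) (simp add: exp_diff right_diff_distrib del: of_nat_Suc)
  qed
  ultimately show ?thesis
    by (auto intro: Lim_transform_eventually)
qed

text \<open>If \<open>z\<close> is not a pole of \<open>Gamma\<close>, then
  \<open>rGamma (z + k) = rGamma z / pochhammer z k\<close>, and the claim is the reciprocal of the
  previous limit. At a pole this quotient becomes 0/0 for large \<open>k\<close>; there the limit is
  carried back from \<open>z + N\<close>, one unit at a time.\<close>

lemma rGamma_asymptotics:
  fixes z :: complex
  shows "(\<lambda>k. rGamma (z + of_nat k) * fact k * of_nat k powr (z - 1)) \<longlonglongrightarrow> 1"
proof -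
  have regular: "(\<lambda>k. rGamma (z + of_nat k) * fact k * of_nat k powr (z - 1)) \<longlonglongrightarrow> 1"
    if z: "z \<notin> \<int>\<^sub>\<le>\<^sub>0" for z :: complex
  proof -
    have nz: "rGamma z \<noteq> 0" using z by (simp add: rGamma_eq_zero_iff)
    have "(\<lambda>k. rGamma z / (pochhammer z k / fact k * of_nat k powr (1 - z))) \<longlonglongrightarrow> rGamma z / rGamma z"
      by (intro tendsto_intros pochhammer_asymptotics nz)
    moreover have "eventually (\<lambda>k. rGamma z / (pochhammer z k / fact k * of_nat k powr (1 - z)) =
        rGamma (z + of_nat k) * fact k * of_nat k powr (z - 1)) sequentially"
      using eventually_gt_at_top[of 0]
    proof eventually_elim
      case (elim k)
      have "pochhammer z k \<noteq> 0"
        using z pochhammer_eq_0_imp_nonpos_Int by blast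
      then show ?case
        using elim pochhammer_rGamma[of z k] by (simp add: powr_diff field_simps)
    qed
    ultimately show ?thesis
      using nz by (auto intro: Lim_transform_eventually)
  qed
  have shift: "(\<lambda>k. rGamma (z + of_nat k) * fact k * of_nat k powr (z - 1)) \<longlonglongrightarrow> 1"
    if "z + of_nat N \<notin> \<int>\<^sub>\<le>\<^sub>0" for N and z :: complex
    using that
  proof (induction N arbitrary: z)
    case 0
    then show ?case using regular by simp
  next
    case (Suc N)
    have "(\<lambda>k. rGamma (z + 1 + of_nat k) * fact k * of_nat k powr (z + 1 - 1)) \<longlonglongrightarrow> 1"
      using Suc.prems by (intro Suc.IH) (simp add: add_ac)
    \<comment> \<open>The limit for \<open>z + 1\<close> at index \<open>k\<close> becomes the one
      for \<open>z\<close> at index \<open>Suc k\<close>: the ratio turns \<open>k powr z\<close>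
      into \<open>Suc k powr z\<close>, and the factor \<open>Suc k\<close> of the next factorial
      accounts for the exponent \<open>z - 1\<close>.\<close>
    then have "(\<lambda>k. (rGamma (z + 1 + of_nat k) * fact k * of_nat k powr (z + 1 - 1)) *
        (of_nat (Suc k) powr z / of_nat k powr z)) \<longlonglongrightarrow> 1 * 1"
      by (intro tendsto_mult of_nat_Suc_powr_ratio)
    moreover have "eventually (\<lambda>k. (rGamma (z + 1 + of_nat k) * fact k * of_nat k powr (z + 1 - 1)) *
        (of_nat (Suc k) powr z / of_nat k powr z) =
        rGamma (z + of_nat (Suc k)) * fact (Suc k) * of_nat (Suc k) powr (z - 1)) sequentially"
      using eventually_gt_at_top[of 0]
    proof eventually_elim
      case (elim k)
      have "complex_of_nat (Suc k) \<noteq> 0" by (simp del: of_nat_Suc)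
      then have "complex_of_nat (Suc k) powr (z - 1) = of_nat (Suc k) powr z / of_nat (Suc k)"
        by (simp add: powr_diff del: of_nat_Suc)
      moreover have "fact (Suc k) = complex_of_nat (Suc k) * fact k"
        by (simp only: fact_Suc)
      moreover have "rGamma (z + of_nat (Suc k)) = rGamma (z + 1 + of_nat k)"
        by (simp add: add_ac)
      ultimately show ?case
        using elim \<open>complex_of_nat (Suc k) \<noteq> 0\<close> by (simp del: of_nat_Suc fact_Suc)
    qed
    ultimately have "(\<lambda>k. rGamma (z + of_nat (Suc k)) * fact (Suc k) * of_nat (Suc k) powr (z - 1)) \<longlonglongrightarrow> 1"
      by (auto intro: Lim_transform_eventually)
    then show ?case
      by (rule LIMSEQ_imp_Suc)
  qed
  obtain N :: nat where N: "real N > norm z"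
    using reals_Archimedean2 by blast
  have "Re (z + of_nat N) > 0"
    using N abs_Re_le_cmod[of z] by simp
  then have "z + of_nat N \<notin> \<int>\<^sub>\<le>\<^sub>0"
    by (rule Re_pos_imp_not_nonpos_Ints)
  then show ?thesis
    by (rule shift)
qed

section \<open>Dirichlet's test and a lower bound for consecutive cosines\<close>

text \<open>Summation by parts: \<open>(w - 1) * c k * w ^ k\<close> is the increment of
  \<open>c k * w ^ k\<close> minus \<open>(c (Suc k) - c k) * w ^ Suc k\<close>. The first
  telescopes because \<open>c\<close> tends to 0, the second is absolutely summable, and
  \<open>w - 1\<close> can be divided out.\<close>

lemma summable_mult_power_bounded_variation:
  fixes c :: "nat \<Rightarrow> 'a :: {banach, real_normed_field}"
  assumes "c \<longlonglongrightarrow> 0" and "summable (\<lambda>k. norm (c (Suc k) - c k))"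
    and w: "norm w = 1" "w \<noteq> 1"
  shows "summable (\<lambda>k. c k * w ^ k)"
proof -
  have "(\<lambda>k. norm (c k * w ^ k)) \<longlonglongrightarrow> 0"
    using assms(1) w by (simp add: norm_mult norm_power tendsto_norm_zero)
  then have "summable (\<lambda>k. c (Suc k) * w ^ Suc k - c k * w ^ k)"
    by (intro telescope_summable) (rule tendsto_norm_zero_cancel)
  moreover have "summable (\<lambda>k. (c (Suc k) - c k) * w ^ Suc k)"
    by (rule summable_norm_cancel) (use assms(2) w in \<open>simp add: norm_mult norm_power\<close>)
  ultimately have "summable (\<lambda>k. (c (Suc k) * w ^ Suc k - c k * w ^ k) - (c (Suc k) - c k) * w ^ Suc k)"
    by (rule summable_diff)
  then have "summable (\<lambda>k. (w - 1) * (c k * w ^ k))"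
    by (simp add: algebra_simps)
  then show ?thesis
    using w by (subst (asm) summable_cmult_iff) auto
qed

text \<open>The addition theorem expresses \<open>sin z * sin b\<close> through the two cosines.
  Were both small, \<open>sin z\<close> and \<open>cos z\<close> would have norm at most 1/2,
  against \<open>sin\<^sup>2 + cos\<^sup>2 = 1\<close>. For real \<open>b\<close>,
  \<open>cos b\<close> is bounded by 1 although \<open>z\<close> is complex.\<close>

lemma cos_shift_not_both_small:
  fixes z :: complex and b :: real
  shows "\<bar>sin b\<bar> / 4 \<le> norm (cos z) \<or> \<bar>sin b\<bar> / 4 \<le> norm (cos (z + of_real b))"
proof (rule ccontr)
  assume "\<not> ?thesis"
  then have small: "norm (cos z) < \<bar>sin b\<bar> / 4" "norm (cos (z + of_real b)) < \<bar>sin b\<bar> / 4"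
    by auto
  have "sin z * of_real (sin b) = cos z * of_real (cos b) - cos (z + of_real b)"
    by (simp add: cos_add sin_of_real cos_of_real)
  then have "norm (sin z) * \<bar>sin b\<bar> = norm (cos z * of_real (cos b) - cos (z + of_real b))"
    by (metis norm_mult norm_of_real)
  also have "\<dots> \<le> norm (cos z) * \<bar>cos b\<bar> + norm (cos (z + of_real b))"
    by (metis norm_triangle_ineq4 norm_mult norm_of_real)
  also have "\<dots> \<le> norm (cos z) + norm (cos (z + of_real b))"
    by (simp add: mult_left_le)
  also have "\<dots> < \<bar>sin b\<bar> / 2"
    using small by simp
  finally have "norm (sin z) * \<bar>sin b\<bar> < 1 / 2 * \<bar>sin b\<bar>"
    by simp
  \<comment> \<open>The strict inequality excludes \<open>sin b = 0\<close>, so this factor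
    cancels.\<close>
  then have s: "norm (sin z) \<le> 1 / 2"
    by (simp only: mult_less_cancel_right) auto
  have c: "norm (cos z) \<le> 1 / 2"
    using small(1) abs_sin_le_one[of b] by linarith
  have "1 = norm ((sin z)\<^sup>2 + (cos z)\<^sup>2)"
    by simp
  also have "\<dots> \<le> (norm (sin z))\<^sup>2 + (norm (cos z))\<^sup>2"
    by (metis norm_power norm_triangle_ineq)
  also have "\<dots> \<le> (1 / 2)\<^sup>2 + (1 / 2)\<^sup>2"
    using s c by (intro add_mono power_mono) auto
  finally show False
    by (simp add: power2_eq_square)
qed

section \<open>Size and increments of the coefficients\<close>

definition series_coeff :: "complex \<Rightarrow> complex \<Rightarrow> nat \<Rightarrow> complex" where
  "series_coeff \<nu> \<mu> k =
     Gamma (\<nu> + \<mu> + of_nat k + 1) * rGamma (\<nu> + of_nat k + 3 / 2) * (pochhammer (\<mu> + 1 / 2) k / fact k)"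

text \<open>The quotient of Gamma values is \<open>?B / ?A\<close> up to powers of \<open>k\<close>;
  the factorials cancel. The exponents \<open>\<nu> + 1/2\<close>, \<open>-(\<nu> + \<mu>)\<close>
  and \<open>1/2 - \<mu>\<close> add up to \<open>1 - 2 * \<mu>\<close>.\<close>

lemma series_coeff_asymptotics:
  "(\<lambda>k. series_coeff \<nu> \<mu> k * of_nat k powr (1 - 2 * \<mu>)) \<longlonglongrightarrow> rGamma (\<mu> + 1 / 2)"
proof -
  let ?A = "\<lambda>k. rGamma ((\<nu> + \<mu> + 1) + of_nat k) * fact k * of_nat k powr ((\<nu> + \<mu> + 1) - 1)"
  let ?B = "\<lambda>k. rGamma ((\<nu> + 3 / 2) + of_nat k) * fact k * of_nat k powr ((\<nu> + 3 / 2) - 1)"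
  let ?P = "\<lambda>k. pochhammer (\<mu> + 1 / 2) k / fact k * of_nat k powr (1 - (\<mu> + 1 / 2))"
  have "(\<lambda>k. ?B k / ?A k * ?P k) \<longlonglongrightarrow> 1 / 1 * rGamma (\<mu> + 1 / 2)"
    by (intro tendsto_mult tendsto_divide rGamma_asymptotics pochhammer_asymptotics) simp
  moreover have "eventually (\<lambda>k. ?B k / ?A k * ?P k =
      series_coeff \<nu> \<mu> k * of_nat k powr (1 - 2 * \<mu>)) sequentially"
    using eventually_gt_at_top[of 0]
  proof eventually_elim
    case (elim k)
    have powr_eq: "(of_nat k powr (1 - 2 * \<mu>) :: complex) = of_nat k powr ((\<nu> + 3 / 2) - 1) /
        of_nat k powr ((\<nu> + \<mu> + 1) - 1) * of_nat k powr (1 - (\<mu> + 1 / 2))"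
      unfolding powr_diff[symmetric] powr_add[symmetric] by (rule arg_cong) simp
    have Gamma_eq: "Gamma (\<nu> + \<mu> + of_nat k + 1) = inverse (rGamma ((\<nu> + \<mu> + 1) + of_nat k))"
      by (simp add: Gamma_def add_ac)
    have rGamma_eq: "rGamma (\<nu> + of_nat k + 3 / 2) = rGamma ((\<nu> + 3 / 2) + of_nat k)"
      by (simp add: add_ac)
    \<comment> \<open>Only \<open>f\<close> must be nonzero: \<open>inverse 0 = 0\<close> covers
      vanishing \<open>r\<close> or \<open>p'\<close>, in agreement with \<open>Gamma\<close> being
      0 at its poles.\<close>
    have cancel: "(R * f * p) / (r * f * p') * (q / f * p'') = inverse r * R * (q / f) * (p / p' * p'')"
      if "f \<noteq> 0" for R f p r p' q p'' :: complex
      using that by (simp add: divide_inverse)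
    show ?case
      unfolding series_coeff_def powr_eq Gamma_eq rGamma_eq by (rule cancel) simp
  qed
  ultimately show ?thesis
    by (auto intro: Lim_transform_eventually)
qed

lemma norm_series_coeff_asymptotics:
  "(\<lambda>k. norm (series_coeff \<nu> \<mu> k) / real k powr (2 * Re \<mu> - 1)) \<longlonglongrightarrow> norm (rGamma (\<mu> + 1 / 2))"
proof -
  have "eventually (\<lambda>k. norm (series_coeff \<nu> \<mu> k * of_nat k powr (1 - 2 * \<mu>)) =
      norm (series_coeff \<nu> \<mu> k) / real k powr (2 * Re \<mu> - 1)) sequentially"
    using eventually_gt_at_top[of 0]
  proof eventually_elim
    case (elim k)
    have "norm (complex_of_nat k powr (1 - 2 * \<mu>)) = real k powr (1 - 2 * Re \<mu>)"
      using norm_powr_real_powr[of "of_nat k" "1 - 2 * \<mu>"] by simp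
    also have "\<dots> = inverse (real k powr (2 * Re \<mu> - 1))"
      by (simp flip: powr_minus)
    finally show ?case by (simp add: norm_mult divide_inverse)
  qed
  then show ?thesis
    using tendsto_norm[OF series_coeff_asymptotics] by (rule Lim_transform_eventually[rotated])
qed

lemma series_coeff_bigo:
  "(\<lambda>k. norm (series_coeff \<nu> \<mu> k)) \<in> O(\<lambda>k. real k powr (2 * Re \<mu> - 1))"
  by (rule bigoI_tendsto[OF norm_series_coeff_asymptotics])
     (use eventually_gt_at_top[of 0] in \<open>auto elim: eventually_mono\<close>)

text \<open>Here \<open>\<mu> + 1/2\<close> has positive real part and so is no zero of
  \<open>rGamma\<close>. The limit of the normalized norms is therefore positive, and half of it
  serves as \<open>d\<close>.\<close>

lemma series_coeff_lower_bound:
  assumes "0 \<le> Re \<mu>"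
  obtains d where "d > 0"
    "eventually (\<lambda>k. d * real k powr (2 * Re \<mu> - 1) \<le> norm (series_coeff \<nu> \<mu> k)) sequentially"
proof
  define L where "L = norm (rGamma (\<mu> + 1 / 2))"
  have "Re (\<mu> + 1 / 2) > 0" using assms by simp
  then have "\<mu> + 1 / 2 \<notin> \<int>\<^sub>\<le>\<^sub>0"
    by (rule Re_pos_imp_not_nonpos_Ints)
  then have L: "L > 0"
    by (simp add: L_def rGamma_eq_zero_iff)
  then show "L / 2 > 0" by simp
  have "eventually (\<lambda>k. L / 2 < norm (series_coeff \<nu> \<mu> k) / real k powr (2 * Re \<mu> - 1)) sequentially"
    by (rule order_tendstoD(1)[OF norm_series_coeff_asymptotics]) (use L in \<open>simp add: L_def\<close>)
  then show "eventually (\<lambda>k. L / 2 * real k powr (2 * Re \<mu> - 1) \<le> norm (series_coeff \<nu> \<mu> k)) sequentially"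
    using eventually_gt_at_top[of 0]
    by eventually_elim (simp add: field_simps)
qed

text \<open>The recurrences give the quotient of consecutive coefficients as
  \<open>(1 + a / p) * (1 + a / q)\<close> with \<open>p = \<nu> + k + 3/2\<close> and
  \<open>q = k + 1\<close>. This is \<open>1 + f k\<close> with \<open>f k\<close> of order
  \<open>1/k\<close>, which gains one power of \<open>k\<close>.\<close>

lemma series_coeff_increment_bigo:
  assumes "\<nu> + \<mu> \<notin> neg_Nats"
  shows "(\<lambda>k. norm (series_coeff \<nu> \<mu> (Suc k) - series_coeff \<nu> \<mu> k)) \<in> O(\<lambda>k. real k powr (2 * Re \<mu> - 2))"
proof -
  define a where "a = \<mu> - 1 / 2"
  define f where "f k = a / (\<nu> + of_nat k + 3 / 2) + a / (of_nat k + 1)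
    + a\<^sup>2 / ((\<nu> + of_nat k + 3 / 2) * (of_nat k + 1))" for k :: nat
  \<comment> \<open>\<open>g\<close> is \<open>k * f k\<close> written in the variable
    \<open>x = 1/k\<close>; continuity at 0 then gives the limit.\<close>
  define g where "g x = a / (1 + (\<nu> + 3 / 2) * x) + a / (1 + x)
    + a\<^sup>2 * x / ((1 + (\<nu> + 3 / 2) * x) * (1 + x))" for x
  obtain N :: nat where N: "real N > norm (\<nu> + 3 / 2)"
    using reals_Archimedean2 by blast
  have nz: "\<nu> + of_nat k + 3 / 2 \<noteq> 0" if "k \<ge> N" for k
  proof
    assume "\<nu> + of_nat k + 3 / 2 = 0"
    then have "\<nu> + 3 / 2 = - of_nat k" by (simp add: eq_neg_iff_add_eq_0 add_ac)
    then have "norm (\<nu> + 3 / 2) = real k" by simp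
    then show False using N that by linarith
  qed
  have nz1: "complex_of_nat k + 1 \<noteq> 0" for k
    by (metis of_nat_Suc of_nat_eq_0_iff nat.distinct(1) add.commute)
  \<comment> \<open>A pole would force \<open>\<nu> + \<mu> = -(n + k + 1)\<close>, and
    \<open>n + k + 1\<close> is at least 1, as membership in \<open>neg_Nats\<close>
    demands.\<close>
  have pole: "\<nu> + \<mu> + of_nat k + 1 \<notin> \<int>\<^sub>\<le>\<^sub>0" for k
  proof
    assume "\<nu> + \<mu> + of_nat k + 1 \<in> \<int>\<^sub>\<le>\<^sub>0"
    then obtain n where "\<nu> + \<mu> + of_nat k + 1 = - of_nat n"
      by (elim nonpos_Ints_cases')
    then have "\<nu> + \<mu> + of_nat (n + k + 1) = 0" by (simp add: add_ac eq_neg_iff_add_eq_0)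
    then have "\<nu> + \<mu> = - of_nat (n + k + 1)" by (simp only: eq_neg_iff_add_eq_0)
    then show False using assms unfolding neg_Nats_def by fastforce
  qed
  have increment: "series_coeff \<nu> \<mu> (Suc k) - series_coeff \<nu> \<mu> k = series_coeff \<nu> \<mu> k * f k"
    if "k \<ge> N" for k
  proof -
    let ?p = "\<nu> + of_nat k + 3 / 2" and ?q = "complex_of_nat k + 1"
    let ?G = "Gamma (\<nu> + \<mu> + of_nat k + 1)" and ?P = "pochhammer (\<mu> + 1 / 2) k / fact k"
    have "Gamma (\<nu> + \<mu> + of_nat (Suc k) + 1) = (?p + a) * ?G"
      using Gamma_plus1[OF pole[of k]] by (simp add: a_def add_ac)
    moreover have "rGamma ?p = ?p * rGamma (\<nu> + of_nat (Suc k) + 3 / 2)"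
      using rGamma_plus1[of ?p] by (simp add: add_ac)
    moreover have "pochhammer (\<mu> + 1 / 2) (Suc k) / fact (Suc k) = (?q + a) / ?q * ?P"
      by (simp add: pochhammer_rec' a_def add_ac)
    ultimately have "series_coeff \<nu> \<mu> (Suc k) =
        (?p + a) * ?G * (rGamma ?p / ?p) * ((?q + a) / ?q * ?P)"
      using nz[OF that] by (simp add: series_coeff_def)
    also have "\<dots> = series_coeff \<nu> \<mu> k * ((?p + a) / ?p * ((?q + a) / ?q))"
      by (simp add: series_coeff_def mult_ac)
    also have "(?p + a) / ?p * ((?q + a) / ?q) = 1 + f k"
      using nz[OF that] nz1[of k] by (simp add: f_def add_divide_distrib ring_distribs power2_eq_square)
    finally show ?thesis by (simp add: ring_distribs)
  qed
  have "(\<lambda>k. g (inverse (of_nat k))) \<longlonglongrightarrow> g 0"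
    unfolding g_def by (intro tendsto_intros lim_inverse_n) auto
  moreover have "eventually (\<lambda>k. g (inverse (of_nat k)) = f k * of_nat k) sequentially"
    using eventually_gt_at_top[of 0] eventually_ge_at_top[of N]
  proof eventually_elim
    case (elim k)
    have "1 + (\<nu> + 3 / 2) * inverse (of_nat k) = (\<nu> + of_nat k + 3 / 2) / of_nat k"
      "1 + inverse (of_nat k) = (complex_of_nat k + 1) / of_nat k"
      using elim by (simp_all add: field_simps)
    then show ?case
      unfolding g_def f_def using elim by (simp add: distrib_right field_simps)
  qed
  ultimately have "(\<lambda>k. f k * of_nat k) \<longlonglongrightarrow> g 0"
    by (rule Lim_transform_eventually)
  from tendsto_norm[OF this] have "(\<lambda>k. norm (f k) / inverse (real k)) \<longlonglongrightarrow> norm (g 0)"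
    by (simp add: norm_mult divide_inverse)
  then have "(\<lambda>k. norm (f k)) \<in> O(\<lambda>k. inverse (real k))"
    by (rule bigoI_tendsto) (use eventually_gt_at_top[of 0] in \<open>auto elim: eventually_mono\<close>)
  then have "(\<lambda>k. norm (series_coeff \<nu> \<mu> k) * norm (f k)) \<in>
      O(\<lambda>k. real k powr (2 * Re \<mu> - 1) * inverse (real k))"
    by (intro landau_o.big.mult series_coeff_bigo)
  also have "(\<lambda>k. norm (series_coeff \<nu> \<mu> k) * norm (f k)) \<in> O(\<lambda>k. real k powr (2 * Re \<mu> - 1) * inverse (real k))
      \<longleftrightarrow> (\<lambda>k. norm (series_coeff \<nu> \<mu> (Suc k) - series_coeff \<nu> \<mu> k)) \<in>
        O(\<lambda>k. real k powr (2 * Re \<mu> - 1) * inverse (real k))"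
    by (intro landau_o.big.in_cong eventually_mono[OF eventually_ge_at_top[of N]])
       (simp add: increment norm_mult)
  also have "O(\<lambda>k. real k powr (2 * Re \<mu> - 1) * inverse (real k)) = O(\<lambda>k. real k powr (2 * Re \<mu> - 2))"
  proof (intro landau_o.big.cong eventually_mono[OF eventually_gt_at_top[of 0]])
    fix k :: nat assume "k > 0"
    then show "real k powr (2 * Re \<mu> - 1) * inverse (real k) = real k powr (2 * Re \<mu> - 2)"
      using powr_diff[of "real k" "2 * Re \<mu> - 1" 1] by (simp add: divide_inverse)
  qed
  finally show ?thesis .
qed

section \<open>Convergence and divergence of the series\<close>

theorem theorem6p2:
  fixes \<theta> :: real and \<nu> \<mu> :: complex
  assumes "0 < \<theta>" and "\<theta> < pi"
    and "\<nu> + \<mu> \<notin> neg_Nats"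
  shows "(Re \<mu> < 0 \<longrightarrow> summable (\<lambda>k. norm (series_term \<nu> \<mu> \<theta> k))) \<and>
    (0 \<le> Re \<mu> \<and> Re \<mu> < 1 / 2 \<longrightarrow>
       summable (series_term \<nu> \<mu> \<theta>) \<and>
       (\<theta> \<noteq> pi / 2 \<longrightarrow> \<not> summable (\<lambda>k. norm (series_term \<nu> \<mu> \<theta> k)))) \<and>
    (1 / 2 \<le> Re \<mu> \<and> \<theta> \<noteq> pi / 2 \<longrightarrow> \<not> summable (series_term \<nu> \<mu> \<theta>))"
proof -
  define c where "c = series_coeff \<nu> \<mu>"
  define K where "K = of_real (sqrt pi) * 2 powr \<mu> * of_real (sin \<theta>) powr \<mu>"
  define \<alpha> where "\<alpha> = (\<nu> + \<mu> + 1) * of_real \<theta>"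
  define C where "C k = cos (\<alpha> + of_nat k * of_real (2 * \<theta>))" for k
  define w where "w = exp (\<i> * of_real (2 * \<theta>))"
  have sin: "sin \<theta> > 0"
    using assms by (simp add: sin_gt_zero)
  have K: "K \<noteq> 0"
    using sin by (simp add: K_def powr_def)
  have C_eq: "cos ((\<nu> + \<mu> + 2 * of_nat k + 1) * of_real \<theta>) = C k" for k
    by (simp add: C_def \<alpha>_def algebra_simps)
  have term_eq: "series_term \<nu> \<mu> \<theta> = (\<lambda>k. K * (c k * C k))"
    by (rule ext) (simp add: series_term_def K_def c_def series_coeff_def C_eq)
  \<comment> \<open>The arguments of the cosines advance by \<open>2 * \<theta>\<close>, so
    \<open>C\<close> is a sum of two geometric sequences. The phase \<open>\<alpha>\<close> may be
    non-real; it enters only the constants \<open>A\<close> and \<open>B\<close>.\<close>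
  define A where "A = exp (\<i> * \<alpha>) / 2"
  define B where "B = exp (- \<i> * \<alpha>) / 2"
  have C_exp: "C k = A * w ^ k + B * inverse w ^ k" for k
  proof -
    let ?t = "of_nat k * of_real (2 * \<theta>) :: complex"
    have "w ^ k = exp (\<i> * ?t)"
      by (simp add: w_def exp_of_nat_mult[symmetric] mult_ac)
    moreover from this have "inverse w ^ k = exp (- (\<i> * ?t))"
      by (simp add: power_inverse exp_minus)
    moreover have "C k = (exp (\<i> * \<alpha> + \<i> * ?t) + exp (- \<i> * \<alpha> + - (\<i> * ?t))) / 2"
      by (simp add: C_def cos_exp_eq distrib_left)
    ultimately show ?thesis
      by (simp only: exp_add A_def B_def) (simp add: add_divide_distrib)
  qed
  have norm_w: "norm w = 1" "norm (inverse w) = 1"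
    by (simp_all add: w_def norm_inverse)
  \<comment> \<open>Since \<open>sin \<theta>\<close> is positive, \<open>Re w < 1\<close>, so
    Dirichlet's test applies to \<open>w\<close> and to its inverse.\<close>
  have "Re w = 1 - 2 * (sin \<theta>)\<^sup>2"
    by (simp add: w_def Re_exp cos_double_sin)
  then have w1: "w \<noteq> 1" "inverse w \<noteq> 1"
    using sin by auto

  \<comment> \<open>The cosines are bounded, and the exponent \<open>2 * Re \<mu> - 1\<close> is
    below -1.\<close>
  have "summable (\<lambda>k. norm (c k * C k))" if "Re \<mu> < 0"
  proof -
    define M where "M = norm A + norm B"
    have "norm (C k) \<le> M" for k
      unfolding C_exp M_def
      by (rule order_trans[OF norm_triangle_ineq])
         (simp only: norm_mult norm_power norm_w power_one mult_1_right order_refl)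
    then have "summable (\<lambda>k. norm (c k) * M) \<Longrightarrow> ?thesis"
      by (elim summable_comparison_test'[of _ 0]) (simp add: norm_mult mult_left_mono)
    moreover have "summable (\<lambda>k. norm (c k))"
      unfolding c_def
      by (rule summable_comparison_test_bigo[OF _ series_coeff_bigo])
         (use that in \<open>simp add: summable_real_powr_iff\<close>)
    ultimately show ?thesis
      by (simp add: summable_mult2)
  qed
  \<comment> \<open>The bound \<open>Re \<mu> < 1/2\<close> serves twice:
    \<open>2 * Re \<mu> - 1 < 0\<close> sends the coefficients to 0, and
    \<open>2 * Re \<mu> - 2 < -1\<close> makes their increments summable.\<close>
  moreover have "summable (\<lambda>k. c k * C k)" if "Re \<mu> < 1 / 2"
  proof -
    have "(\<lambda>k. real k powr (2 * Re \<mu> - 1)) \<longlonglongrightarrow> 0"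
      using that by (intro tendsto_neg_powr filterlim_real_sequentially) simp
    then have "(\<lambda>k. real k powr (2 * Re \<mu> - 1)) \<in> o(\<lambda>k. 1)"
      by (intro smalloI_tendsto) simp_all
    then have "(\<lambda>k. norm (c k)) \<in> o(\<lambda>k. 1)"
      unfolding c_def by (rule landau_o.big_small_trans[OF series_coeff_bigo])
    from smalloD_tendsto[OF this] have c0: "c \<longlonglongrightarrow> 0"
      by (simp add: tendsto_norm_zero_iff)
    have var: "summable (\<lambda>k. norm (c (Suc k) - c k))"
      unfolding c_def
      by (rule summable_comparison_test_bigo[OF _ series_coeff_increment_bigo[OF assms(3)]])
         (use that in \<open>simp add: summable_real_powr_iff\<close>)
    have "summable (\<lambda>k. A * (c k * w ^ k) + B * (c k * inverse w ^ k))"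
      by (intro summable_add[OF summable_mult summable_mult]
            summable_mult_power_bounded_variation[OF c0 var] norm_w w1)
    also have "(\<lambda>k. A * (c k * w ^ k) + B * (c k * inverse w ^ k)) = (\<lambda>k. c k * C k)"
      by (simp only: C_exp distrib_left mult_ac)
    finally show ?thesis .
  qed
  \<comment> \<open>Which of the two cosines is large is unknown, and the exponent may have either
    sign; the minimum of the two powers covers every case.\<close>
  moreover have pair_bound: "\<exists>d>0. \<forall>\<^sub>F k in sequentially.
      d * min (real k powr (2 * Re \<mu> - 1)) (real (Suc k) powr (2 * Re \<mu> - 1)) \<le>
      norm (c k * C k) + norm (c (Suc k) * C (Suc k))"
    if "0 \<le> Re \<mu>" "\<theta> \<noteq> pi / 2"
  proof -
    define s where "s = \<bar>sin (2 * \<theta>)\<bar> / 4"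
    \<comment> \<open>Injectivity of the cosine on \<open>[0, pi]\<close> leaves
      \<open>pi / 2\<close> as its only zero there; hence \<open>sin (2 * \<theta>)\<close> is
      nonzero.\<close>
    have "cos \<theta> \<noteq> 0"
    proof
      assume "cos \<theta> = 0"
      then have "cos \<theta> = cos (pi / 2)" by simp
      then show False using assms that cos_inj_pi[of \<theta> "pi / 2"] by simp
    qed
    then have s: "s > 0"
      using sin by (simp add: s_def sin_double)
    obtain d where d: "d > 0"
      and ev: "eventually (\<lambda>k. d * real k powr (2 * Re \<mu> - 1) \<le> norm (c k)) sequentially"
      using series_coeff_lower_bound[OF \<open>0 \<le> Re \<mu>\<close>, where \<nu> = \<nu>, folded c_def] by blast
    have "eventually (\<lambda>k. (d * s) * min (real k powr (2 * Re \<mu> - 1)) (real (Suc k) powr (2 * Re \<mu> - 1)) \<le>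
        norm (c k * C k) + norm (c (Suc k) * C (Suc k))) sequentially"
      using ev eventually_sequentially_Suc[THEN iffD2, OF ev]
    proof eventually_elim
      case (elim k)
      let ?r = "\<lambda>k. real k powr (2 * Re \<mu> - 1)"
      have C_Suc: "C (Suc k) = cos ((\<alpha> + of_nat k * of_real (2 * \<theta>)) + of_real (2 * \<theta>))"
        by (simp add: C_def algebra_simps)
      have "s \<le> norm (C k) \<or> s \<le> norm (C (Suc k))"
        unfolding C_Suc unfolding C_def s_def by (rule cos_shift_not_both_small)
      then consider "s \<le> norm (C k)" | "s \<le> norm (C (Suc k))"
        by blast
      then show ?case
      proof cases
        case 1
        have "d * s * min (?r k) (?r (Suc k)) \<le> d * s * ?r k"
          using d s by (intro mult_left_mono) auto
        also have "\<dots> = (d * ?r k) * s" by simp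
        also have "\<dots> \<le> norm (c k) * norm (C k)"
          using 1 s elim(1) by (intro mult_mono) auto
        also have "\<dots> \<le> norm (c k * C k) + norm (c (Suc k) * C (Suc k))"
          by (simp add: norm_mult)
        finally show ?thesis .
      next
        case 2
        have "d * s * min (?r k) (?r (Suc k)) \<le> d * s * ?r (Suc k)"
          using d s by (intro mult_left_mono) auto
        also have "\<dots> = (d * ?r (Suc k)) * s" by simp
        also have "\<dots> \<le> norm (c (Suc k)) * norm (C (Suc k))"
          using 2 s elim(2) by (intro mult_mono) auto
        also have "\<dots> \<le> norm (c k * C k) + norm (c (Suc k) * C (Suc k))"
          by (simp add: norm_mult)
        finally show ?thesis .
      qed
    qed
    then show ?thesis
      using d s by (intro exI[of _ "d * s"]) auto
  qed
  moreover have "\<not> summable (\<lambda>k. norm (c k * C k))" if "0 \<le> Re \<mu>" "\<theta> \<noteq> pi / 2"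
  proof
    assume "summable (\<lambda>k. norm (c k * C k))"
    then have sum: "summable (\<lambda>k. norm (c k * C k) + norm (c (Suc k) * C (Suc k)))"
      by (intro summable_add) (simp_all only: summable_Suc_iff[where f = "\<lambda>k. norm (c k * C k)"])
    obtain d where d: "d > 0" and ev: "\<forall>\<^sub>F k in sequentially.
        d * min (real k powr (2 * Re \<mu> - 1)) (real (Suc k) powr (2 * Re \<mu> - 1)) \<le>
        norm (c k * C k) + norm (c (Suc k) * C (Suc k))"
      using pair_bound[OF \<open>0 \<le> Re \<mu>\<close> \<open>\<theta> \<noteq> pi / 2\<close>] by blast
    \<comment> \<open>The exponent is at least -1, so both powers dominate
      \<open>1 / (k + 1)\<close>, and the pair sums dominate a multiple of the harmonic
      series.\<close>
    have "\<forall>\<^sub>F k in sequentially. norm (d * inverse (real (Suc k))) \<le>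
        norm (c k * C k) + norm (c (Suc k) * C (Suc k))"
      using ev eventually_gt_at_top[of 0]
    proof eventually_elim
      case (elim k)
      have "inverse (real (Suc k)) \<le> real (Suc k) powr (2 * Re \<mu> - 1)"
        using that powr_mono[of "-1" "2 * Re \<mu> - 1" "real (Suc k)"] by (simp add: powr_minus)
      moreover have "inverse (real (Suc k)) \<le> inverse (real k)"
        using elim by (simp add: le_imp_inverse_le)
      moreover have "inverse (real k) \<le> real k powr (2 * Re \<mu> - 1)"
        using elim that powr_mono[of "-1" "2 * Re \<mu> - 1" "real k"] by (simp add: powr_minus)
      ultimately have "d * inverse (real (Suc k)) \<le>
          d * min (real k powr (2 * Re \<mu> - 1)) (real (Suc k) powr (2 * Re \<mu> - 1))"
        using d by (intro mult_left_mono) linarith+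
      moreover have "norm (d * inverse (real (Suc k))) = d * inverse (real (Suc k))"
        using d by simp
      ultimately show ?case
        using elim by linarith
    qed
    from summable_comparison_test_ev[OF this sum] have "summable (\<lambda>k. d * inverse (real (Suc k)))" .
    then have "summable (\<lambda>k. inverse (real (Suc k)))"
      using d by (subst (asm) summable_cmult_iff) auto
    then have "summable (\<lambda>k. inverse (real k))"
      by (simp only: summable_Suc_iff[where f = "\<lambda>k. inverse (real k)"])
    then show False
      using not_summable_harmonic[where 'a = real] by simp
  qed
  moreover have "\<not> summable (\<lambda>k. c k * C k)" if "1 / 2 \<le> Re \<mu>" "\<theta> \<noteq> pi / 2"
  proof
    assume "summable (\<lambda>k. c k * C k)"
    then have "(\<lambda>k. norm (c k * C k)) \<longlonglongrightarrow> 0"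
      by (intro tendsto_norm_zero summable_LIMSEQ_zero)
    then have lim: "(\<lambda>k. norm (c k * C k) + norm (c (Suc k) * C (Suc k))) \<longlonglongrightarrow> 0 + 0"
      by (intro tendsto_add) (auto dest: LIMSEQ_Suc)
    have "0 \<le> Re \<mu>" using that by simp
    then obtain d where d: "d > 0" and ev: "\<forall>\<^sub>F k in sequentially.
        d * min (real k powr (2 * Re \<mu> - 1)) (real (Suc k) powr (2 * Re \<mu> - 1)) \<le>
        norm (c k * C k) + norm (c (Suc k) * C (Suc k))"
      using pair_bound \<open>\<theta> \<noteq> pi / 2\<close> by blast
    \<comment> \<open>The exponent is now nonnegative, so both powers are at least 1 for positive
      \<open>k\<close>, and the terms cannot tend to 0.\<close>
    have "\<forall>\<^sub>F k in sequentially. d \<le> norm (c k * C k) + norm (c (Suc k) * C (Suc k))"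
      using ev eventually_gt_at_top[of 0]
    proof eventually_elim
      case (elim k)
      have "1 \<le> min (real k powr (2 * Re \<mu> - 1)) (real (Suc k) powr (2 * Re \<mu> - 1))"
        using elim that by (simp add: ge_one_powr_ge_zero)
      then have "d * 1 \<le> d * min (real k powr (2 * Re \<mu> - 1)) (real (Suc k) powr (2 * Re \<mu> - 1))"
        using d by (intro mult_left_mono) auto
      then show ?case
        using elim by linarith
    qed
    then have "d \<le> 0 + 0"
      by (intro tendsto_lowerbound[OF lim]) auto
    then show False
      using d by simp
  qed
  ultimately show ?thesis
    using K by (simp add: term_eq norm_mult)
qed

end
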